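(* Let $Q$ be a prime power, let $h(x)\in\mathbb{F}_Q[x]$, let $r,m,n$ be positive integers such that $mn\equiv 1\pmod{Q-1}$, and put $q=Q^m$. Then $x^r h\bigl(x^{(q-1)/(Q-1)}\bigr)$ permutes $\mathbb{F}_q$ if and only if both of the following hold: (1) $\gcd\bigl(r,(q-1)/(Q-1)\bigr)=1$; and (2) $g(x):=x^{rn} h(x)$ permutes $\mathbb{F}_Q$.
   Context: For a prime power $Q$, $\mathbb{F}_Q$ denotes the finite field with $Q$ elements, and it is regarded as a subfield of $\mathbb{F}_{Q^m}$. A polynomial $f(x)$ permutes a finite field $\mathbb{F}$ if the function $\alpha\mapsto f(\alpha)$ is a bijection from $\mathbb{F}$ to itself. *)

theory Defs
  imports
    "HOL-Algebra.Algebraic_Closure_Type"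
    "HOL-Number_Theory.Prime_Powers"
    "HOL-Number_Theory.Cong"
begin

(* A field F is given here as a subset of an ambient ring type. For a subfield F of the
   ambient field, f is meant to have its coefficients in F (the definition itself only looks
   at the function induced by f on F). *)
definition poly_permutes :: "'a::comm_semiring_0 poly \<Rightarrow> 'a set \<Rightarrow> bool" where
  "poly_permutes f F \<longleftrightarrow> bij_betw (poly f) F F"

end

theory Submission
  imports Defs
begin

text \<open>
  Put \<open>s = (q - 1) div (Q - 1)\<close>. The polynomial map \<open>f\<close> is semiconjugate under the norm
  \<open>x \<mapsto> x ^ s\<close>, which maps the large field onto \<open>K\<close>, to \<open>G y = y ^ r * h y ^ m\<close>:
  on \<open>K\<close> exponents only matter modulo \<open>Q - 1\<close>, and \<open>s \<equiv> m\<close> there.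
  On each norm fibre over a nonzero \<open>y\<close>, \<open>f\<close> is a multiple of \<open>x \<mapsto> x ^ r\<close>, which is injective
  on the fibre iff \<open>r\<close> is coprime to \<open>s\<close>. Finally, \<open>G y ^ n\<close> is the value of the
  polynomial \<open>g\<close> at \<open>y\<close>, and \<open>w \<mapsto> w ^ n\<close> is a bijection of \<open>K\<close> with inverse \<open>w \<mapsto> w ^ m\<close>.
\<close>

lemma finite_roots_power_eq:
  fixes c :: "'a::idom"
  assumes "n > 0"
  shows "finite {x. x ^ n = c}" and "card {x. x ^ n = c} \<le> n"
proof -
  define p where "p = Polynomial.monom 1 n - [:c:]"
  have deg: "Polynomial.degree p = n"
    unfolding p_def using assms
    by (subst diff_conv_add_uminus, subst Polynomial.degree_add_eq_left)
       (simp_all add: Polynomial.degree_monom_eq)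
  have "p \<noteq> 0" using deg assms by auto
  moreover have "{x. x ^ n = c} = {x. poly p x = 0}"
    by (simp add: p_def poly_monom)
  ultimately show "finite {x. x ^ n = c}" and "card {x. x ^ n = c} \<le> n"
    using poly_roots_finite[of p] card_poly_roots_bound[of p] deg by simp_all
qed

text \<open>Multiplication by \<open>a\<close> is injective on the finite set \<open>S\<close>,
  hence permutes it; comparing the product over \<open>S\<close> before and after and cancelling
  gives the claim.\<close>

lemma power_card_eq_1:
  fixes S :: "'a::idom set"
  assumes "finite S" "0 \<notin> S" "\<And>a b. a \<in> S \<Longrightarrow> b \<in> S \<Longrightarrow> a * b \<in> S" "a \<in> S"
  shows "a ^ card S = 1"
proof -
  have "inj_on ((*) a) S"
    using assms by (intro inj_onI) auto
  moreover have "(*) a ` S \<subseteq> S" using assms by auto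
  ultimately have "bij_betw ((*) a) S S"
    using assms(1) by (simp add: bij_betw_def endo_inj_surj)
  then have "prod (\<lambda>x. a * x) S = prod (\<lambda>x. x) S"
    by (rule prod.reindex_bij_betw)
  then have "a ^ card S * \<Prod>S = 1 * \<Prod>S"
    by (simp add: prod.distrib)
  moreover have "\<Prod>S \<noteq> 0" using assms by auto
  ultimately show ?thesis by simp
qed

text \<open>For nonzero \<open>x\<close> the order divides \<open>N\<close>. Positive exponents let
  the statement cover \<open>x = 0\<close> too, where \<open>0 ^ 0 = 1\<close> would break
  it.\<close>

lemma power_cong_exponent:
  fixes x :: "'a::idom"
  assumes "x ^ Suc N = x" "[a = b] (mod N)" "a > 0" "b > 0"
  shows "x ^ a = x ^ b"
proof (cases "x = 0")
  case False
  then have "x ^ N = 1" using assms(1) by simp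
  then have "x ^ k = x ^ (k mod N)" for k
    by (subst mult_div_mod_eq[of N k, symmetric], subst power_add) (simp add: power_mult)
  then show ?thesis using assms(2) unfolding cong_def by metis
qed (use assms in \<open>simp add: power_0_left\<close>)

lemma power_eq_imp_eq_of_coprime:
  fixes x y :: "'a::field"
  assumes "coprime a b" "x ^ a = y ^ a" "x ^ b = y ^ b" "a > 0"
  shows "x = y"
proof (cases "y = 0")
  case False
  define z where "z = x / y"
  have za: "z ^ a = 1" and zb: "z ^ b = 1"
    using assms False by (simp_all add: z_def power_divide)
  \<comment> \<open>Bezout over the naturals, with the remainder term on the side of
    \<open>b\<close>; this form requires \<open>a > 0\<close>.\<close>
  obtain u v where "a * u = Suc (b * v)"
    using bezout_nat[of a b] assms(1,4) by (auto simp: coprime_iff_gcd_eq_1)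
  then have "(z ^ a) ^ u = z * (z ^ b) ^ v"
    by (simp flip: power_mult)
  then show ?thesis using za zb False by (simp add: z_def)
qed (use assms in \<open>simp add: power_0_left\<close>)

lemma subfield_closed:
  fixes K :: "'a::field set"
  assumes "subfield K (ring_of_type_algebra :: 'a ring)"
  shows "0 \<in> K" "1 \<in> K"
    and "\<And>a b. a \<in> K \<Longrightarrow> b \<in> K \<Longrightarrow> a * b \<in> K"
    and "\<And>a b. a \<in> K \<Longrightarrow> b \<in> K \<Longrightarrow> a + b \<in> K"
  using subringE[OF subfieldE(1)[OF assms]] by (simp_all add: ring_of_type_algebra_def)

lemma subfield_power_closed:
  fixes K :: "'a::field set"
  assumes "subfield K (ring_of_type_algebra :: 'a ring)" "a \<in> K"
  shows "a ^ n \<in> K"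
  by (induction n) (use assms subfield_closed[OF assms(1)] in auto)

lemma subfield_poly_closed:
  fixes K :: "'a::field set"
  assumes "subfield K (ring_of_type_algebra :: 'a ring)"
    and "\<And>i. Polynomial.coeff p i \<in> K" and "a \<in> K"
  shows "poly p a \<in> K"
proof -
  have "(\<Sum>i\<le>n. Polynomial.coeff p i * a ^ i) \<in> K" for n
    by (induction n) (use assms subfield_closed[OF assms(1)]
        subfield_power_closed[OF assms(1)] in auto)
  then show ?thesis by (simp add: poly_altdef)
qed

text \<open>Every element of \<open>K\<close> is zero or a root of unity of exponent
  \<open>card K - 1\<close>. There are at most \<open>card K\<close> such elements in the whole
  field, so \<open>K\<close> exhausts them.\<close>

lemma finite_subfield_eq_roots:
  fixes K :: "'a::field set"
  assumes "subfield K (ring_of_type_algebra :: 'a ring)" "finite K"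
  shows "K = {x. x ^ card K = x}"
proof -
  note cl = subfield_closed[OF assms(1)]
  have Q: "card K > 1"
    using card_mono[of K "{0, 1}"] cl assms(2) by auto
  have card: "card (K - {0}) = card K - 1" using cl by simp
  have sub: "K \<subseteq> insert 0 {x. x ^ (card K - 1) = 1}"
    using power_card_eq_1[of "K - {0}"] cl assms(2) by (auto simp: card)
  have eq: "insert 0 {x::'a. x ^ (card K - 1) = 1} = {x. x ^ card K = x}"
  proof -
    obtain N where "card K = Suc N" using Q by (cases "card K") auto
    then show ?thesis by auto
  qed
  have fin: "finite {x::'a. x ^ (card K - 1) = 1}"
    and "card {x::'a. x ^ (card K - 1) = 1} \<le> card K - 1"
    using finite_roots_power_eq[of "card K - 1" "1::'a"] Q by auto
  then have "card (insert 0 {x::'a. x ^ (card K - 1) = 1}) \<le> card K"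
    using Q by (auto simp: card_insert_if)
  with sub fin show ?thesis
    unfolding eq[symmetric] by (intro card_seteq) auto
qed

text \<open>Counting: the fibres have at most \<open>s\<close> elements, so the image has at least \<open>N\<close>.\<close>
lemma power_map_surj:
  fixes y :: "'a::{field,finite}"
  assumes "card (UNIV :: 'a set) - 1 = s * N" "s > 0" "N > 0" "y ^ N = 1"
  obtains x where "x ^ s = y"
proof -
  have one: "x ^ (s * N) = 1" if "x \<noteq> 0" for x :: 'a
    using power_card_eq_1[of "UNIV - {0::'a}" x] that assms(1) by simp
  define I where "I = (\<lambda>x::'a. x ^ s) ` (UNIV - {0})"
  have "UNIV - {0::'a} \<subseteq> (\<Union>y\<in>I. {x. x ^ s = y})" by (auto simp: I_def)
  then have "card (UNIV - {0::'a}) \<le> card (\<Union>y\<in>I. {x. x ^ s = y})"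
    by (intro card_mono) auto
  also have "\<dots> \<le> (\<Sum>y\<in>I. card {x. x ^ s = y})" by (rule card_UN_le) simp
  also have "\<dots> \<le> (\<Sum>y\<in>I. s)"
    by (intro sum_mono finite_roots_power_eq assms)
  finally have "N \<le> card I" using assms by (simp add: mult.commute)
  moreover have "I \<subseteq> {y. y ^ N = 1}"
    using one by (auto simp: I_def simp flip: power_mult)
  ultimately have "I = {y. y ^ N = 1}"
    using finite_roots_power_eq[of N "1::'a"] assms(3) by (intro card_seteq) auto
  then have "y \<in> I" using assms(4) by simp
  then show ?thesis using that by (auto simp: I_def)
qed

text \<open>Take \<open>z = x ^ k\<close> with \<open>k\<close> the cofactor of \<open>d\<close> in
  the group order. As \<open>k\<close> is smaller than that order, the root bound leaves some
  nonzero \<open>x\<close> with \<open>x ^ k \<noteq> 1\<close>.\<close>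

lemma nontrivial_root_of_unity:
  assumes "d dvd card (UNIV :: 'a::{field,finite} set) - 1" "d > 1"
  obtains z :: "'a::{field,finite}" where "z ^ d = 1" "z \<noteq> 1"
proof -
  let ?M = "card (UNIV :: 'a set) - 1"
  have M: "card (UNIV - {0::'a}) = ?M" by simp
  have "1 \<in> UNIV - {0::'a}" by simp
  then have "?M > 0" using M by (metis card_gt_0_iff empty_iff finite)
  with assms obtain k where k: "?M = d * k" "k > 0" by fastforce
  then have "k < ?M" using assms(2) by simp
  have "\<exists>x\<in>UNIV - {0::'a}. x ^ k \<noteq> 1"
  proof (rule ccontr)
    assume "\<not> ?thesis"
    then have "UNIV - {0::'a} \<subseteq> {x. x ^ k = 1}" by auto
    then have "?M \<le> card {x::'a. x ^ k = 1}"
      unfolding M[symmetric] by (intro card_mono) auto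
    with finite_roots_power_eq(2)[OF k(2), of "1::'a"] \<open>k < ?M\<close> show False by linarith
  qed
  then obtain x :: 'a where x: "x \<noteq> 0" "x ^ k \<noteq> 1" by auto
  have "x ^ ?M = 1"
    using power_card_eq_1[of "UNIV - {0::'a}" x] x by simp
  then have "(x ^ k) ^ d = 1" unfolding k by (simp add: mult.commute flip: power_mult)
  then show ?thesis using x that by blast
qed

text \<open>The quotient is the geometric sum of the \<open>Q ^ i\<close> for \<open>i < m\<close>,
  and each of these \<open>m\<close> terms is 1 modulo \<open>Q - 1\<close>.\<close>

lemma geometric_quotient_cong:
  fixes Q m :: nat
  assumes "Q > 1"
  defines "s \<equiv> (Q ^ m - 1) div (Q - 1)"
  shows "Q ^ m - 1 = s * (Q - 1)" and "[s = m] (mod (Q - 1))"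
proof -
  have "Q ^ m - 1 = (\<Sum>i<m. Q ^ i) * (Q - 1)"
  proof -
    \<comment> \<open>The factorisation is taken over the integers to avoid truncated
      subtraction.\<close>
    have "int Q ^ m - 1 = (int Q - 1) * (\<Sum>i<m. int Q ^ i)"
      by (rule power_diff_1_eq)
    moreover have "int (Q ^ m - 1) = int Q ^ m - 1" using assms by (simp add: of_nat_diff)
    moreover have "int (Q - 1) = int Q - 1" using assms by simp
    ultimately have "int (Q ^ m - 1) = int ((\<Sum>i<m. Q ^ i) * (Q - 1))"
      by (simp add: mult.commute)
    then show ?thesis by linarith
  qed
  then have s: "s = (\<Sum>i<m. Q ^ i)" and "Q ^ m - 1 = s * (Q - 1)"
    using assms(1) by (simp_all add: s_def)
  then show "Q ^ m - 1 = s * (Q - 1)" by simp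
  have "[Q = 1] (mod (Q - 1))"
    using assms(1) by (metis cong_def le_add_diff_inverse less_imp_le mod_add_self2)
  then have "[(\<Sum>i<m. Q ^ i) = (\<Sum>i<m. 1 ^ i)] (mod (Q - 1))"
    by (intro cong_sum cong_pow)
  then show "[s = m] (mod (Q - 1))" by (simp add: s)
qed

text \<open>The power map \<open>w ^ n\<close> has left inverse \<open>w ^ m\<close> on
  \<open>K\<close>, so composing with it neither creates nor destroys injectivity; on the finite set
  \<open>K\<close> this decides bijectivity.\<close>

lemma bij_betw_power_compose_iff:
  fixes G g :: "'a::idom \<Rightarrow> 'a"
  assumes "\<And>x. x \<in> K \<Longrightarrow> G x \<in> K" "\<And>x. x \<in> K \<Longrightarrow> g x = G x ^ n"
    and "\<And>w. w \<in> K \<Longrightarrow> w ^ (m * n) = w" "\<And>w. w \<in> K \<Longrightarrow> w ^ n \<in> K" "finite K"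
  shows "bij_betw g K K \<longleftrightarrow> bij_betw G K K"
proof -
  have inj: "inj_on (\<lambda>w. w ^ n) K"
    by (rule inj_on_inverseI[of _ "\<lambda>w. w ^ m"]) (simp add: assms(3) mult.commute flip: power_mult)
  have "g ` K \<subseteq> K" "G ` K \<subseteq> K" using assms by auto
  then have "bij_betw g K K \<longleftrightarrow> inj_on g K" "bij_betw G K K \<longleftrightarrow> inj_on G K"
    using assms(5) by (auto simp: bij_betw_def endo_inj_surj)
  moreover have "inj_on g K \<longleftrightarrow> inj_on G K"
    using assms(1,2) inj unfolding inj_on_def by metis
  ultimately show ?thesis by simp
qed

theorem corollary1p3:
  fixes Q q r m n :: nat
    and K :: "'a::finite_field set"
    and h :: "'a poly"
  assumes "primepow Q"
    and "r > 0" and "m > 0" and "n > 0"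
    and "[m * n = 1] (mod (Q - 1))"
    and "q = Q ^ m"
    and "card (UNIV :: 'a set) = q"
    and "subfield K (ring_of_type_algebra :: 'a ring)" and "card K = Q"
    and "\<forall>i. Polynomial.coeff h i \<in> K"
  shows "poly_permutes
           (Polynomial.monom 1 r * pcompose h (Polynomial.monom 1 ((q - 1) div (Q - 1))))
           (UNIV :: 'a set)
         \<longleftrightarrow> gcd r ((q - 1) div (Q - 1)) = 1
           \<and> poly_permutes (Polynomial.monom 1 (r * n) * h) K"
proof -
  define s where "s = (q - 1) div (Q - 1)"
  have Q: "Q > 1" using assms(1) by (rule primepow_gt_Suc_0[folded One_nat_def])
  have qs: "q - 1 = s * (Q - 1)" and scong: "[s = m] (mod (Q - 1))"
    using geometric_quotient_cong[OF Q, of m] by (simp_all add: s_def assms(6))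
  have "q > 1" using one_less_power[OF Q assms(3)] assms(6) by simp
  then have s0: "s > 0" using qs by (cases s) auto
  have K: "K = {x. x ^ Q = x}"
    using finite_subfield_eq_roots[OF assms(8)] assms(9) by simp
  note cl = subfield_closed[OF assms(8)] subfield_power_closed[OF assms(8)]
  have hK: "poly h y \<in> K" if "y \<in> K" for y
    using subfield_poly_closed[OF assms(8)] assms(10) that by blast
  have expK: "x ^ a = x ^ b" if "x \<in> K" "[a = b] (mod (Q - 1))" "a > 0" "b > 0" for x a b
    using power_cong_exponent[of x "Q - 1" a b] that Q by (simp add: K)
  define f where "f = (\<lambda>x::'a. x ^ r * poly h (x ^ s))"
  define G where "G = (\<lambda>y. y ^ r * poly h y ^ m)"
  have GK: "G y \<in> K" if "y \<in> K" for y
    unfolding G_def by (intro cl(3,5) hK that)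
  have norm_K: "x ^ s \<in> K" for x :: 'a
  proof (cases "x = 0")
    case False
    then have "x ^ (q - 1) = 1"
      using power_card_eq_1[of "UNIV - {0::'a}" x] assms(7) by simp
    then have "(x ^ s) ^ (Q - 1) = 1" unfolding qs by (simp only: power_mult)
    then show ?thesis using Q by (simp add: K power_eq_if)
  qed (use s0 cl in simp)
  have norm_surj: "\<exists>x. x ^ s = y" if "y \<in> K" for y
  proof (cases "y = 0")
    case False
    then have "y ^ (Q - 1) = 1" using that Q by (simp add: K power_eq_if)
    then show ?thesis
      using power_map_surj[of s "Q - 1" y] qs assms(7) s0 Q by auto
  qed (use s0 in \<open>auto intro: exI[of _ 0]\<close>)
  have semiconj: "f x ^ s = G (x ^ s)" for x
  proof -
    \<comment> \<open>The value of \<open>h\<close> at a norm lies in \<open>K\<close>, so its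
      exponent \<open>s\<close> may be traded for \<open>m\<close>.\<close>
    have "poly h (x ^ s) ^ s = poly h (x ^ s) ^ m"
      by (rule expK[OF hK[OF norm_K] scong s0 assms(3)])
    then show ?thesis
      by (simp add: f_def G_def power_mult_distrib mult.commute flip: power_mult)
  qed
  have "poly (Polynomial.monom 1 r * pcompose h (Polynomial.monom 1 s)) = f"
    by (rule ext) (simp add: f_def poly_monom poly_pcompose)
  then have f: "poly_permutes (Polynomial.monom 1 r * pcompose h (Polynomial.monom 1 s)) UNIV
           \<longleftrightarrow> bij f"
    by (simp add: poly_permutes_def)
  have root: "w ^ (m * n) = w" if "w \<in> K" for w
    using expK[OF that, of "m * n" 1] assms by simp
  have "poly_permutes (Polynomial.monom 1 (r * n) * h) K \<longleftrightarrow> bij_betw G K K"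
    unfolding poly_permutes_def
  proof (rule bij_betw_power_compose_iff[OF GK _ root])
    fix y assume "y \<in> K"
    then show "poly (Polynomial.monom 1 (r * n) * h) y = G y ^ n"
      \<comment> \<open>The factor \<open>poly h y\<close> equals its own power with exponent
        \<open>m * n\<close>, which turns the value of \<open>g\<close> into an \<open>n\<close>-th
        power.\<close>
      using root[OF hK] by (simp add: G_def poly_monom power_mult_distrib flip: power_mult)
  qed (use cl(5) in auto)
  moreover have "bij f \<longleftrightarrow> gcd r s = 1 \<and> bij_betw G K K"
  proof (intro iffI conjI)
    assume "bij f"
    show "gcd r s = 1"
    proof (rule ccontr)
      assume "gcd r s \<noteq> 1"
      moreover have "gcd r s > 0" using s0 by simp
      ultimately have "gcd r s > 1" by linarith
      moreover have "gcd r s dvd card (UNIV :: 'a set) - 1" unfolding assms(7) qs by simp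
      \<comment> \<open>A nontrivial root of unity of exponent \<open>gcd r s\<close> collides with
        1: neither \<open>x ^ r\<close> nor \<open>x ^ s\<close> separates them.\<close>
      ultimately obtain z :: 'a where z: "z ^ gcd r s = 1" "z \<noteq> 1"
        using nontrivial_root_of_unity by blast
      have "z ^ r = 1" "z ^ s = 1"
        using z(1) by (metis dvdE gcd_dvd1 gcd_dvd2 power_mult power_one)+
      then have "f z = f 1" by (simp add: f_def)
      then show False using \<open>bij f\<close> z(2) by (metis bij_is_inj injD)
    qed
    \<comment> \<open>Surjectivity passes from \<open>f\<close> to \<open>G\<close> because the norm
      is onto \<open>K\<close>; finiteness then gives injectivity.\<close>
    have "K \<subseteq> G ` K"
    proof
      fix y assume "y \<in> K"
      then obtain x where "x ^ s = y" using norm_surj by blast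
      moreover obtain x' where "x = f x'" using \<open>bij f\<close> by (metis bij_pointE)
      ultimately show "y \<in> G ` K" using semiconj norm_K by blast
    qed
    then have "G ` K = K" using GK by blast
    then show "bij_betw G K K" by (simp add: bij_betw_def eq_card_imp_inj_on)
  next
    assume "gcd r s = 1 \<and> bij_betw G K K"
    then have gcd: "gcd r s = 1" and G: "bij_betw G K K" by simp_all
    have "x = y" if eq: "f x = f y" for x y
    proof -
      have "G (x ^ s) = G (y ^ s)" using eq by (simp flip: semiconj)
      then have ns: "x ^ s = y ^ s"
        using G norm_K by (auto simp: bij_betw_def dest: inj_onD)
      show ?thesis
      proof (cases "x = 0")
        case True
        then show ?thesis using ns s0 by (simp add: power_0_left)
      next
        case False
        \<comment> \<open>Otherwise \<open>G\<close> would take the value 0 both at the nonzero norm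
          \<open>x ^ s\<close> and at 0, against injectivity.\<close>
        have "poly h (x ^ s) \<noteq> 0"
        proof
          assume "poly h (x ^ s) = 0"
          then have "G (x ^ s) = G 0" using assms(2,3) by (simp add: G_def power_0_left)
          then have "x ^ s = 0"
            using G norm_K cl(1) by (auto simp: bij_betw_def dest: inj_onD)
          then show False using False by simp
        qed
        \<comment> \<open>Equal norms give equal factors \<open>poly h (x ^ s)\<close>, which
          cancel.\<close>
        then have "x ^ r = y ^ r" using eq ns by (simp add: f_def)
        then show ?thesis
          using power_eq_imp_eq_of_coprime[of r s x y] ns gcd assms(2)
          by (simp add: coprime_iff_gcd_eq_1)
      qed
    qed
    then have "inj f" by (rule injI)
    then show "bij f" by (simp add: bij_def finite_UNIV_inj_surj)
  qed
  ultimately show ?thesis unfolding s_def[symmetric] f by simp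
qed

end
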